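(* Let $n \ge 1$ be an integer and let $A$ and $B$ be any two complex positive semidefinite $n \times n$ matrices. Then the polynomial $\lambda(t) = \operatorname{Tr}\left[(A + tB)^p\right]$ in the variable $t$ has nonnegative coefficients when $p = 7$.
   Context: Positive semidefinite complex matrices are understood to be Hermitian. $\operatorname{Tr}$ denotes the matrix trace. For each $r$, the coefficient of $t^r$ in $\lambda(t)$ is the trace of the sum of all words of length $p$ in the letters $A$ and $B$ in which exactly $r$ letters are $B$; "nonnegative" means that each of these coefficients is a real number $\ge 0$. *)

theory Defs
  imports "HOL-Analysis.Analysis" "HOL-Computational_Algebra.Polynomial"
begin

definition conj_transpose :: "complex^'n^'m \<Rightarrow> complex^'m^'n" where
  "conj_transpose A = map_matrix cnj (transpose A)"

definition hermitian :: "complex^'n^'n \<Rightarrow> bool" where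
  "hermitian A \<longleftrightarrow> conj_transpose A = A"

definition pos_semidef :: "complex^'n^'n \<Rightarrow> bool" where
  "pos_semidef A \<longleftrightarrow>
     hermitian A \<and> (\<forall>x. (\<Sum>i\<in>UNIV. cnj (x $ i) * (A *v x) $ i) \<in> \<real>\<^sub>\<ge>\<^sub>0)"

(* The overloaded power on square matrices is the entrywise one, hence a separate
   function for powers with respect to the matrix product. *)
primrec mat_power :: "'a::semiring_1^'n^'n \<Rightarrow> nat \<Rightarrow> 'a^'n^'n" where
  "mat_power M 0 = mat 1"
| "mat_power M (Suc k) = M ** mat_power M k"

(* Tr ((A + t B)^p) as a formal polynomial in t: the matrix A + t B, the power and
   the trace are all taken over the ring of complex polynomials. *)
definition trace_power_poly :: "nat \<Rightarrow> complex^'n^'n \<Rightarrow> complex^'n^'n \<Rightarrow> complex poly" where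
  "trace_power_poly p A B =
     trace (mat_power (map_matrix (\<lambda>a. [:a:]) A + map_matrix (\<lambda>b. monom b 1) B) p)"

lemma map_matrix_poly_mat_power:
  "map_matrix (\<lambda>q. poly q t) (mat_power M k) = mat_power (map_matrix (\<lambda>q. poly q t) M) k"
  for M :: "complex poly^'n^'n"
proof (induction k)
  case 0
  show ?case by (simp add: vec_eq_iff mat_def)
next
  case (Suc k)
  show ?case
    unfolding mat_power.simps Suc.IH [symmetric]
    by (simp add: vec_eq_iff matrix_matrix_mult_def poly_sum)
qed

lemma poly_trace_power_poly:
  "poly (trace_power_poly p A B) t = trace (mat_power (A + map_matrix (\<lambda>b. t * b) B) p)"
proof -
  have "poly (trace_power_poly p A B) t =
        trace (map_matrix (\<lambda>q. poly q t)
          (mat_power (map_matrix (\<lambda>a. [:a:]) A + map_matrix (\<lambda>b. monom b 1) B) p))"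
    by (simp add: trace_power_poly_def trace_def poly_sum)
  also have "\<dots> = trace (mat_power (A + map_matrix (\<lambda>b. t * b) B) p)"
    unfolding map_matrix_poly_mat_power
    by (rule arg_cong [where f = "\<lambda>M. trace (mat_power M p)"])
       (simp add: vec_eq_iff poly_monom mult.commute)
  finally show ?thesis .
qed

end

theory Submission
  imports Defs
begin

text \<open>
  The coefficient of \<open>t\<^sup>r\<close> is the sum of the traces of all words of length \<open>7\<close> with \<open>r\<close> letters
  \<open>B\<close> (\<open>coeff_trace_power_poly\<close>), and the trace of a word depends only on its cyclic
  rotation class (\<open>word_trace_rotate\<close>).  Exchanging \<open>A\<close> and \<open>B\<close> reflects the coefficients
  (\<open>sum_words_swap\<close>), so \<open>r \<le> 3\<close> suffices.  As \<open>7\<close> is prime, each class of a non-constant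
  word has exactly \<open>7\<close> members, so for \<open>1 \<le> r \<le> 3\<close> the coefficient is \<open>7\<close> times a sum over classes.

  The positivity comes from \<open>Tr (X\<^sup>* M X) \<ge> 0\<close> for positive semidefinite \<open>M\<close>.  When \<open>X\<close> is a
  word \<open>u\<close>, this says that the trace of the odd palindrome \<open>u\<^sup>* M u\<close> is nonnegative.  For
  \<open>r \<le> 2\<close> every class contains such a palindrome.  For \<open>r = 3\<close> there are five classes; writing
  the lengths of the gaps between the letters \<open>B\<close>, they are \<open>(4,0,0)\<close>, \<open>(3,1,0)\<close>, \<open>(3,0,1)\<close>,
  \<open>(2,2,0)\<close> and \<open>(2,1,1)\<close>.  The second and third are exchanged by reversal and contain no
  palindrome, and their traces need not be nonnegative (or even real).  They occur, however, as the
  mixed terms of a Hermitian square: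
  \<open>Tr ((ABA + BAA)\<^sup>* B (ABA + BAA))\<close> is exactly the sum of one representative of each of
  \<open>(2,1,1)\<close>, \<open>(3,1,0)\<close>, \<open>(3,0,1)\<close> and \<open>(4,0,0)\<close>.  The remaining class \<open>(2,2,0)\<close> contains
  the palindrome \<open>BAABAAB\<close>.
\<close>

section \<open>Positive semidefinite matrices and the trace\<close>

lemma conj_transpose_mult: "conj_transpose (M ** N) = conj_transpose N ** conj_transpose M"
  by (simp add: conj_transpose_def vec_eq_iff transpose_def matrix_matrix_mult_def mult.commute)

lemma conj_transpose_add: "conj_transpose (M + N) = conj_transpose M + conj_transpose N"
  by (simp add: conj_transpose_def vec_eq_iff transpose_def)

lemma conj_transpose_one: "conj_transpose (mat 1) = mat 1"
  by (simp add: conj_transpose_def vec_eq_iff transpose_def mat_def)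

lemma matrix_add_rdistrib:
  fixes M N :: "'a::semiring_1^'n^'m"
  shows "(M + N) ** P = M ** P + N ** P"
  by (simp add: vec_eq_iff matrix_matrix_mult_def distrib_right sum.distrib)

lemma nonneg_Reals_sum:
  fixes f :: "'i \<Rightarrow> 'a::real_algebra_1"
  assumes "\<And>i. i \<in> S \<Longrightarrow> f i \<in> \<real>\<^sub>\<ge>\<^sub>0"
  shows "sum f S \<in> \<real>\<^sub>\<ge>\<^sub>0"
  using assms by (induction S rule: infinite_finite_induct) (auto intro: nonneg_Reals_add_I)

text \<open>
  The \<open>j\<close>-th diagonal entry is the quadratic form of \<open>M\<close> at the \<open>j\<close>-th column of \<open>X\<close>.
\<close>
lemma trace_congruence_nonneg:
  fixes M X :: "complex^'n^'n"
  assumes "pos_semidef M"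
  shows "trace (conj_transpose X ** M ** X) \<in> \<real>\<^sub>\<ge>\<^sub>0"
proof -
  have "(conj_transpose X ** M ** X) $ j $ j =
      (\<Sum>i\<in>UNIV. cnj (column j X $ i) * (M *v column j X) $ i)" for j
    unfolding matrix_mul_assoc [symmetric]
    by (simp add: conj_transpose_def transpose_def column_def matrix_matrix_mult_def
        matrix_vector_mult_def)
  then have "(conj_transpose X ** M ** X) $ j $ j \<in> \<real>\<^sub>\<ge>\<^sub>0" for j
    using assms by (simp add: pos_semidef_def)
  then show ?thesis
    unfolding trace_def by (intro nonneg_Reals_sum) simp
qed

section \<open>Traces of words\<close>

definition word_prod :: "('a::semiring_1^'n^'n) list \<Rightarrow> 'a^'n^'n" where
  "word_prod w = foldr (**) w (mat 1)"

abbreviation word_trace :: "('a::semiring_1^'n^'n) list \<Rightarrow> 'a" where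
  "word_trace w \<equiv> trace (word_prod w)"

lemma word_prod_Nil: "word_prod [] = mat 1"
  and word_prod_Cons: "word_prod (M # w) = M ** word_prod w"
  by (simp_all add: word_prod_def)

lemma word_prod_append: "word_prod (u @ v) = word_prod u ** word_prod v"
  by (induction u) (simp_all add: word_prod_Nil word_prod_Cons matrix_mul_assoc)

lemma word_trace_rotate:
  fixes w :: "('a::comm_semiring_1^'n^'n) list"
  shows "word_trace (rotate k w) = word_trace w"
proof -
  have "word_trace (rotate1 u) = word_trace u" for u :: "('a^'n^'n) list"
    by (cases u) (simp_all add: word_prod_append word_prod_Cons word_prod_Nil trace_mul_sym [of "word_prod _"])
  then show ?thesis
    by (induction k) simp_all
qed

lemma conj_transpose_word_prod:
  assumes "\<forall>M\<in>set w. hermitian M"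
  shows "conj_transpose (word_prod w) = word_prod (rev w)"
  using assms
  by (induction w)
     (simp_all add: word_prod_Nil word_prod_Cons word_prod_append conj_transpose_one
        conj_transpose_mult hermitian_def)

lemma word_trace_palindrome_nonneg:
  assumes "pos_semidef M" and "\<forall>N\<in>set u. hermitian N"
  shows "word_trace (rev u @ M # u) \<in> \<real>\<^sub>\<ge>\<^sub>0"
  using trace_congruence_nonneg [OF assms(1), of "word_prod u"]
  by (simp add: word_prod_append word_prod_Cons conj_transpose_word_prod assms(2) matrix_mul_assoc)

text \<open>
  The expansion of a Hermitian square of a sum of two words.  Its point is that the two mixed terms,
  which have no sign individually, are controlled by the two palindromes.
\<close>
lemma word_trace_binomial_nonneg:
  assumes "pos_semidef M" and "\<forall>N\<in>set u \<union> set v. hermitian N"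
  shows "word_trace (rev u @ M # u) + word_trace (rev u @ M # v)
       + word_trace (rev v @ M # u) + word_trace (rev v @ M # v) \<in> \<real>\<^sub>\<ge>\<^sub>0"
proof -
  have "conj_transpose (word_prod u + word_prod v) = word_prod (rev u) + word_prod (rev v)"
    using assms(2) by (simp add: conj_transpose_add conj_transpose_word_prod)
  then show ?thesis
    using trace_congruence_nonneg [OF assms(1), of "word_prod u + word_prod v"]
    by (simp add: word_prod_append word_prod_Cons matrix_mul_assoc matrix_add_ldistrib
        matrix_add_rdistrib trace_add add_ac)
qed

section \<open>The coefficients as sums over words\<close>

text \<open>
  All words of length \<open>k\<close> over \<open>a\<close> and \<open>b\<close> with exactly \<open>r\<close> letters \<open>b\<close>.  A list rather than
  a set, so that \<open>A = B\<close> does not identify different words and so that rewriting can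
  enumerate the words for given numerals.
\<close>
primrec words :: "'a \<Rightarrow> 'a \<Rightarrow> nat \<Rightarrow> nat \<Rightarrow> 'a list list" where
  "words a b 0 r = (if r = 0 then [[]] else [])"
| "words a b (Suc k) r = map (Cons a) (words a b k r) @
     (case r of 0 \<Rightarrow> [] | Suc s \<Rightarrow> map (Cons b) (words a b k s))"

lemma words_eq_Nil: "k < r \<Longrightarrow> words a b k r = []"
  by (induction k arbitrary: r) (auto split: nat.split)

lemma sum_words_swap:
  fixes f :: "'a list \<Rightarrow> 'b::comm_monoid_add"
  assumes "r \<le> k"
  shows "(\<Sum>w\<leftarrow>words a b k r. f w) = (\<Sum>w\<leftarrow>words b a k (k - r). f w)"
  using assms
proof (induction k arbitrary: r f)
  case 0
  then show ?case by simp
next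
  case (Suc k)
  show ?case
  proof (cases r)
    case 0
    then show ?thesis
      using Suc.IH [of 0 "f \<circ> Cons a"] by (simp add: words_eq_Nil o_def)
  next
    case (Suc s)
    have b: "(\<Sum>w\<leftarrow>words a b k s. f (b # w)) = (\<Sum>w\<leftarrow>words b a k (k - s). f (b # w))"
      using Suc.IH [of s "f \<circ> Cons b"] Suc.prems Suc by (simp add: o_def)
    show ?thesis
    proof (cases "s = k")
      case True
      then show ?thesis
        using b Suc by (simp add: words_eq_Nil o_def)
    next
      case False
      then have "(\<Sum>w\<leftarrow>words a b k r. f (a # w)) = (\<Sum>w\<leftarrow>words b a k (k - r). f (a # w))"
        using Suc.IH [of r "f \<circ> Cons a"] Suc.prems Suc by (simp add: o_def)
      moreover have "k - s = Suc (k - r)"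
        using False Suc Suc.prems by simp
      ultimately show ?thesis
        using b Suc by (simp add: o_def add.commute)
    qed
  qed
qed

lemma matrix_mul_sum_list:
  fixes M :: "'a::semiring_1^'n^'n"
  shows "M ** (\<Sum>x\<leftarrow>xs. f x) = (\<Sum>x\<leftarrow>xs. M ** f x)"
  by (induction xs) (simp_all add: matrix_add_ldistrib)

lemma trace_sum_list:
  fixes f :: "'b \<Rightarrow> 'a::comm_semiring_1^'n^'n"
  shows "trace (\<Sum>x\<leftarrow>xs. f x) = (\<Sum>x\<leftarrow>xs. trace (f x))"
  by (induction xs) (simp_all add: trace_def sum.distrib)

text \<open>
  Splitting off the first factor \<open>A + t B\<close> of the power gives the recursion that defines
  \<^const>\<open>words\<close>.
\<close>
lemma coeff_mat_power:
  fixes A B :: "'a::comm_semiring_1^'n^'n"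
  defines "P \<equiv> map_matrix (\<lambda>a. [:a:]) A + map_matrix (\<lambda>b. monom b 1) B"
  shows "map_matrix (\<lambda>q. coeff q r) (mat_power P k) = (\<Sum>w\<leftarrow>words A B k r. word_prod w)"
proof (induction k arbitrary: r)
  case 0
  show ?case
    by (simp add: word_prod_Nil vec_eq_iff mat_def)
next
  case (Suc k)
  have "map_matrix (\<lambda>q. coeff q r) (P ** Q) = A ** map_matrix (\<lambda>q. coeff q r) Q +
      (case r of 0 \<Rightarrow> 0 | Suc s \<Rightarrow> B ** map_matrix (\<lambda>q. coeff q s) Q)"
    for Q :: "'a poly^'n^'n"
    by (simp add: P_def vec_eq_iff matrix_matrix_mult_def coeff_sum distrib_right
        coeff_monom_mult sum.distrib split: nat.split)
  then show ?case
    by (simp add: Suc.IH matrix_mul_sum_list word_prod_Cons o_def split: nat.split)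
qed

lemma coeff_trace_power_poly:
  fixes A B :: "complex^'n^'n"
  shows "coeff (trace_power_poly p A B) r = (\<Sum>w\<leftarrow>words A B p r. word_trace w)"
proof -
  have "coeff (trace Q) r = trace (map_matrix (\<lambda>q. coeff q r) Q)" for Q :: "complex poly^'n^'n"
    by (simp add: trace_def coeff_sum)
  then show ?thesis
    by (simp only: trace_power_poly_def coeff_mat_power trace_sum_list)
qed

section \<open>Nonnegativity for exponent seven\<close>

text \<open>
  The rotations of a word of length \<open>7\<close>, written out letter by letter.  Instantiated with a
  representative and reversed, these are rewrite rules that collect its whole rotation class.
\<close>
lemma word_trace_rotations7:
  fixes a b c d e f g :: "'a::comm_semiring_1^'n^'n"
  shows "word_trace [a,b,c,d,e,f,g] = word_trace [b,c,d,e,f,g,a]"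
    and "word_trace [a,b,c,d,e,f,g] = word_trace [c,d,e,f,g,a,b]"
    and "word_trace [a,b,c,d,e,f,g] = word_trace [d,e,f,g,a,b,c]"
    and "word_trace [a,b,c,d,e,f,g] = word_trace [e,f,g,a,b,c,d]"
    and "word_trace [a,b,c,d,e,f,g] = word_trace [f,g,a,b,c,d,e]"
    and "word_trace [a,b,c,d,e,f,g] = word_trace [g,a,b,c,d,e,f]"
proof -
  let ?w = "[a,b,c,d,e,f,g]"
  show "word_trace ?w = word_trace [b,c,d,e,f,g,a]"
    using word_trace_rotate [of 1 ?w] by (simp add: numeral_eq_Suc)
  show "word_trace ?w = word_trace [c,d,e,f,g,a,b]"
    using word_trace_rotate [of 2 ?w] by (simp add: numeral_eq_Suc)
  show "word_trace ?w = word_trace [d,e,f,g,a,b,c]"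
    using word_trace_rotate [of 3 ?w] by (simp add: numeral_eq_Suc)
  show "word_trace ?w = word_trace [e,f,g,a,b,c,d]"
    using word_trace_rotate [of 4 ?w] by (simp add: numeral_eq_Suc)
  show "word_trace ?w = word_trace [f,g,a,b,c,d,e]"
    using word_trace_rotate [of 5 ?w] by (simp add: numeral_eq_Suc)
  show "word_trace ?w = word_trace [g,a,b,c,d,e,f]"
    using word_trace_rotate [of 6 ?w] by (simp add: numeral_eq_Suc)
qed

lemma sum_words7_nonneg:
  fixes A B :: "complex^'n^'n"
  assumes A: "pos_semidef A" and B: "pos_semidef B" and "r \<le> 3"
  shows "(\<Sum>w\<leftarrow>words A B 7 r. word_trace w) \<in> \<real>\<^sub>\<ge>\<^sub>0"
proof -
  have herm [simp]: "hermitian A" "hermitian B"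
    using A B by (simp_all add: pos_semidef_def)
  consider "r = 0" | "r = 1" | "r = 2" | "r = 3"
    using \<open>r \<le> 3\<close> by linarith
  then show ?thesis
  proof cases
    case 1
    have "(\<Sum>w\<leftarrow>words A B 7 0. word_trace w) = word_trace [A,A,A,A,A,A,A]"
      by (simp add: numeral_eq_Suc)
    then show ?thesis
      using word_trace_palindrome_nonneg [OF A, of "[A,A,A]"] 1 by simp
  next
    case 2
    have "(\<Sum>w\<leftarrow>words A B 7 1. word_trace w) = 7 * word_trace [A,A,A,B,A,A,A]"
      by (simp add: numeral_eq_Suc
          word_trace_rotations7 [of A A A B A A A, symmetric])
    then show ?thesis
      using word_trace_palindrome_nonneg [OF B, of "[A,A,A]"] 2 by simp
  next
    case 3
    \<comment> \<open>The classes with gaps \<open>(5,0)\<close>, \<open>(4,1)\<close> and \<open>(3,2)\<close>, in this order.\<close>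
    have "(\<Sum>w\<leftarrow>words A B 7 2. word_trace w) = 7 *
        (word_trace [B,A,A,A,A,A,B] + word_trace [A,A,B,A,B,A,A] + word_trace [A,B,A,A,A,B,A])"
      by (simp add: numeral_eq_Suc
          word_trace_rotations7 [of B A A A A A B, symmetric]
          word_trace_rotations7 [of A A B A B A A, symmetric]
          word_trace_rotations7 [of A B A A A B A, symmetric])
    then show ?thesis
      using word_trace_palindrome_nonneg [OF A, of "[A,A,B]"]
        word_trace_palindrome_nonneg [OF A, of "[B,A,A]"]
        word_trace_palindrome_nonneg [OF A, of "[A,B,A]"] 3 by simp
  next
    case 4
    \<comment> \<open>The inner bracket is the expansion of \<open>(ABA + BAA)\<^sup>* B (ABA + BAA)\<close>.\<close>
    have "(\<Sum>w\<leftarrow>words A B 7 3. word_trace w) = 7 *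
        (word_trace [B,A,A,B,A,A,B] +
         (word_trace [A,B,A,B,A,B,A] + word_trace [A,B,A,B,B,A,A]
        + word_trace [A,A,B,B,A,B,A] + word_trace [A,A,B,B,B,A,A]))"
      by (simp add: numeral_eq_Suc
          word_trace_rotations7 [of B A A B A A B, symmetric]
          word_trace_rotations7 [of A B A B A B A, symmetric]
          word_trace_rotations7 [of A B A B B A A, symmetric]
          word_trace_rotations7 [of A A B B A B A, symmetric]
          word_trace_rotations7 [of A A B B B A A, symmetric])
    then show ?thesis
      using word_trace_palindrome_nonneg [OF B, of "[A,A,B]"]
        word_trace_binomial_nonneg [OF B, of "[A,B,A]" "[B,A,A]"] 4
      by (simp del: distrib_left_numeral)
  qed
qed

theorem mainTheorem1:
  fixes A B :: "complex^'n^'n"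
  assumes "pos_semidef A" and "pos_semidef B"
  shows "\<forall>r. coeff (trace_power_poly 7 A B) r \<in> \<real>\<^sub>\<ge>\<^sub>0"
proof
  fix r :: nat
  consider "r \<le> 3" | "4 \<le> r" "r \<le> 7" | "7 < r"
    by linarith
  then show "coeff (trace_power_poly 7 A B) r \<in> \<real>\<^sub>\<ge>\<^sub>0"
  proof cases
    case 1
    then show ?thesis
      using assms by (simp add: coeff_trace_power_poly sum_words7_nonneg)
  next
    case 2
    then have "(\<Sum>w\<leftarrow>words B A 7 (7 - r). word_trace w) \<in> \<real>\<^sub>\<ge>\<^sub>0"
      using assms by (intro sum_words7_nonneg) auto
    then show ?thesis
      using 2 by (simp add: coeff_trace_power_poly sum_words_swap [of r 7 _ A])
  next
    case 3
    then show ?thesis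
      by (simp add: coeff_trace_power_poly words_eq_Nil)
  qed
qed

end
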